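(* Let $f\colon\mathbb{R}^n\to[-\infty,+\infty]$ be a proper nearly convex function and let $D\subset\mathbb{R}^n$ be a nonempty nearly convex set. Let $\mathcal S$ be the solution set of the problem $\min\{f(x)\mid x\in D\}$. Then a point $\bar x\in D$ with $f(\bar x)\in\mathbb{R}$ is a solution of this problem if and only if $0\in\partial(f+\delta_D)(\bar x)$. Moreover, if the regularity condition $(\mathrm{ri}\,D)\cap\mathrm{ri}(\mathrm{dom}\,f)\neq\emptyset$ holds, then a point $\bar x\in D$ is a solution of the problem if and only if $$0\in\partial f(\bar x)+N(\bar x;D);$$ hence $\mathcal S=\{\bar x\in\mathbb{R}^n\mid 0\in\partial f(\bar x)+N(\bar x;D)\}$.
   Context: A set $\Omega\subset\mathbb{R}^n$ is nearly convex if there is a convex set $C\subset\mathbb{R}^n$ with $C\subset\Omega\subset\bar C$, where the bar on a set denotes topological closure. For an arbitrary set $\Omega$, $\mathrm{ri}\,\Omega$ is the interior of $\Omega$ relative to its affine hull. For $f\colon\mathbb{R}^n\to[-\infty,+\infty]$: $\mathrm{dom}\,f=\{x\mid f(x)<+\infty\}$, $\mathrm{epi}\,f=\{(x,\lambda)\in\mathbb{R}^n\times\mathbb{R}\mid f(x)\le\lambda\}$; $f$ is proper if $\mathrm{dom}\,f\ne\emptyset$ and $f(x)>-\infty$ for all $x$; $f$ is nearly convex if $\mathrm{epi}\,f$ is a nearly convex set. $\delta_D(x)=0$ if $x\in D$ and $\delta_D(x)=+\infty$ otherwise. For a function $h\colon\mathbb{R}^n\to[-\infty,+\infty]$ and $\bar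 x$ with $h(\bar x)\in\mathbb{R}$, $\partial h(\bar x)=\{x^*\in\mathbb{R}^n\mid\langle x^*,x-\bar x\rangle\le h(x)-h(\bar x)\ \text{for all }x\in\mathbb{R}^n\}$; set $\partial h(\bar x)=\emptyset$ if $h(\bar x)\notin\mathbb{R}$. The normal cone to a nearly convex set $\Omega$ is $N(\bar x;\Omega)=\{x^*\in\mathbb{R}^n\mid\langle x^*,x-\bar x\rangle\le0\ \text{for all }x\in\Omega\}$ if $\bar x\in\Omega$, and $N(\bar x;\Omega)=\emptyset$ if $\bar x\notin\Omega$. A solution of a problem $\min\{h(x)\mid x\in E\}$ is a point $\bar x\in E$ with $h(\bar x)\le h(x)$ for all $x\in E$. *)

theory Defs
  imports "HOL-Analysis.Analysis"
begin

definition nearly_convex :: "'a::euclidean_space set \<Rightarrow> bool" where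
  "nearly_convex \<Omega> \<longleftrightarrow> (\<exists>C. convex C \<and> C \<subseteq> \<Omega> \<and> \<Omega> \<subseteq> closure C)"

definition eff_domain :: "('a::euclidean_space \<Rightarrow> ereal) \<Rightarrow> 'a set" where
  "eff_domain f = {x. f x < \<infinity>}"

definition ereal_epigraph :: "('a::euclidean_space \<Rightarrow> ereal) \<Rightarrow> ('a \<times> real) set" where
  "ereal_epigraph f = {(x, t). f x \<le> ereal t}"

definition proper_function :: "('a::euclidean_space \<Rightarrow> ereal) \<Rightarrow> bool" where
  "proper_function f \<longleftrightarrow> eff_domain f \<noteq> {} \<and> (\<forall>x. f x > -\<infinity>)"

definition nearly_convex_function :: "('a::euclidean_space \<Rightarrow> ereal) \<Rightarrow> bool" where
  "nearly_convex_function f \<longleftrightarrow> nearly_convex (ereal_epigraph f)"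

text \<open>The indicator function of convex analysis: zero on the set, infinite off it.\<close>

definition convex_indicator :: "'a::euclidean_space set \<Rightarrow> 'a \<Rightarrow> ereal" where
  "convex_indicator D x = (if x \<in> D then 0 else \<infinity>)"

text \<open>The condition \<open>\<bar>h xbar\<bar> \<noteq> \<infinity>\<close> says that \<open>h xbar\<close> is a real number;
  without it the difference \<open>h x - h xbar\<close> could take the conventional value
  \<open>\<infinity> - \<infinity> = \<infinity>\<close>.\<close>

definition subdifferential :: "('a::euclidean_space \<Rightarrow> ereal) \<Rightarrow> 'a \<Rightarrow> 'a set" where
  "subdifferential h xbar =
     (if \<bar>h xbar\<bar> \<noteq> \<infinity>
      then {v. \<forall>x. ereal (v \<bullet> (x - xbar)) \<le> h x - h xbar} else {})"

definition normal_cone :: "'a::euclidean_space \<Rightarrow> 'a set \<Rightarrow> 'a set" where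
  "normal_cone xbar \<Omega> =
     (if xbar \<in> \<Omega> then {v. \<forall>x\<in>\<Omega>. v \<bullet> (x - xbar) \<le> 0} else {})"

definition solution_set :: "('a::euclidean_space \<Rightarrow> ereal) \<Rightarrow> 'a set \<Rightarrow> 'a set" where
  "solution_set h E = {xbar \<in> E. \<forall>x\<in>E. h xbar \<le> h x}"

end

(* The content is the existence of a subgradient v at a solution xbar with -v normal to D.
   Put m = f xbar. The epigraph of f and D \<times> {t. t < m} are disjoint, and so are the convex sets
   of which they are near-closures; separate the latter properly. Taking closures gives
   a functional (a, b), not constant on epi f - D \<times> {..m}, whose values on D \<times> {..m} lie below
   those on epi f. Both sets contain (xbar, m), so b \<ge> 0. If b = 0, then at a common relative
   interior point of D and dom f the functional a attains both its minimum over dom f and its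
   maximum over D, hence is constant on both, contradicting properness. So b > 0, and v = -a / b. *)
theory Submission
  imports Defs
begin

text \<open>A segment from \<open>x\<close> to a relative interior point \<open>z\<close> can be
  prolonged slightly beyond \<open>z\<close> inside \<open>S\<close>. If the functional were larger
  at \<open>x\<close> than at \<open>z\<close>, it would drop below its minimum on this
  prolongation.\<close>

lemma inner_minimum_rel_interior_constant:
  fixes S :: "'a::euclidean_space set"
  assumes z: "z \<in> rel_interior S" and min: "\<And>x. x \<in> S \<Longrightarrow> a \<bullet> z \<le> a \<bullet> x" and "x \<in> S"
  shows "a \<bullet> x = a \<bullet> z"
proof -
  obtain e where zS: "z \<in> S" and e: "e > 0" "cball z e \<inter> affine hull S \<subseteq> S"
    using z mem_rel_interior_cball[of z S] by blast
  \<comment> \<open>The summand 1 keeps the quotient defined when \<open>x = z\<close>; the step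
    from \<open>z\<close> then has length at most \<open>e\<close>.\<close>
  define t where "t = e / (norm (x - z) + 1)"
  have t: "t > 0" "t * norm (x - z) \<le> e"
    using e(1) by (auto simp: t_def field_simps add_pos_nonneg)
  define y where "y = z - t *\<^sub>R (x - z)"
  have "y = (1 + t) *\<^sub>R z + (- t) *\<^sub>R x"
    by (simp add: y_def algebra_simps)
  moreover have "z \<in> affine hull S" "x \<in> affine hull S"
    using zS \<open>x \<in> S\<close> hull_subset by fastforce+
  ultimately have "y \<in> affine hull S"
    using mem_affine[OF affine_affine_hull, of z S x "1 + t" "- t"] by simp
  moreover have "y \<in> cball z e"
    using t by (simp add: y_def dist_norm)
  ultimately have "a \<bullet> z \<le> a \<bullet> y"
    using e(2) min by blast
  then have "t * (a \<bullet> x - a \<bullet> z) \<le> 0"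
    by (simp add: y_def inner_diff_right)
  then have "a \<bullet> x \<le> a \<bullet> z"
    using t(1) by (simp add: mult_le_0_iff)
  then show ?thesis
    using min[OF \<open>x \<in> S\<close>] by simp
qed

text \<open>Strictness for some pair comes from choosing \<open>a\<close> in the span of the
  difference set \<open>U\<close>: if \<open>a\<close> vanished on \<open>U\<close>, it would be
  orthogonal to that span, hence to itself.\<close>

lemma separating_hyperplane_proper:
  fixes S T :: "'a::euclidean_space set"
  assumes "convex S" "convex T" "S \<noteq> {}" "T \<noteq> {}" "S \<inter> T = {}"
  obtains a where "\<And>x y. x \<in> closure S \<Longrightarrow> y \<in> closure T \<Longrightarrow> a \<bullet> y \<le> a \<bullet> x"
    and "\<exists>x\<in>S. \<exists>y\<in>T. a \<bullet> y < a \<bullet> x"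
proof -
  define U where "U = (\<Union>x\<in>S. \<Union>y\<in>T. {x - y})"
  have "convex U"
    unfolding U_def using assms(1,2) by (rule convex_differences)
  moreover have "U \<noteq> {}" "0 \<notin> U"
    using assms(3-5) by (auto simp: U_def)
  ultimately obtain a where a: "a \<in> span U" "a \<noteq> 0" "\<And>u. u \<in> U \<Longrightarrow> 0 \<le> a \<bullet> u"
    using separating_hyperplane_set_0_inspan[of U] by metis
  have le: "a \<bullet> y \<le> a \<bullet> x" if "x \<in> S" "y \<in> T" for x y
  proof -
    have "x - y \<in> U"
      using that by (auto simp: U_def)
    from a(3)[OF this] show ?thesis
      by (simp add: inner_diff_right)
  qed
  have cont: "continuous_on X (\<lambda>x. a \<bullet> x)" for X
    by (intro continuous_intros)
  have le': "a \<bullet> y \<le> a \<bullet> x" if "x \<in> closure S" "y \<in> T" for x y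
    using continuous_ge_on_closure[OF cont that(1)] le that(2) by blast
  have "a \<bullet> y \<le> a \<bullet> x" if "x \<in> closure S" "y \<in> closure T" for x y
    using continuous_le_on_closure[OF cont that(2)] le' that(1) by blast
  moreover have "\<exists>x\<in>S. \<exists>y\<in>T. a \<bullet> y < a \<bullet> x"
  proof (rule ccontr)
    assume const: "\<not> ?thesis"
    have "a \<bullet> u = 0" if u: "u \<in> U" for u
    proof -
      obtain x y where "x \<in> S" "y \<in> T" "u = x - y"
        using u by (auto simp: U_def)
      then show ?thesis
        using le[of x y] const by (force simp: inner_diff_right)
    qed
    then have "orthogonal a a"
      using orthogonal_to_span[OF a(1), of a] by (simp add: orthogonal_def)
    then show False
      using a(2) by (simp add: orthogonal_def)
  qed
  ultimately show ?thesis
    by (rule that)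
qed

lemma solution_set_imp_subgradient:
  fixes f :: "'a::euclidean_space \<Rightarrow> ereal" and D :: "'a set"
  assumes proper: "proper_function f" and "nearly_convex_function f" and "nearly_convex D"
    and z: "z \<in> rel_interior D" "z \<in> rel_interior (eff_domain f)"
    and sol: "xbar \<in> solution_set f D"
  obtains v where "v \<in> subdifferential f xbar" "- v \<in> normal_cone xbar D"
proof -
  have zD: "z \<in> D" and zf: "z \<in> eff_domain f"
    using z rel_interior_subset by blast+
  have xD: "xbar \<in> D" and opt: "\<And>x. x \<in> D \<Longrightarrow> f xbar \<le> f x"
    using sol by (auto simp: solution_set_def)
  have "f xbar < \<infinity>" "f xbar > -\<infinity>"
    using opt[OF zD] zf proper by (auto simp: eff_domain_def proper_function_def)
  then obtain m where m: "f xbar = ereal m"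
    by (cases "f xbar") auto
  obtain C where C: "convex C" "C \<subseteq> ereal_epigraph f" "ereal_epigraph f \<subseteq> closure C"
    using assms(2) by (auto simp: nearly_convex_function_def nearly_convex_def)
  obtain E where E: "convex E" "E \<subseteq> D" "D \<subseteq> closure E"
    using assms(3) by (auto simp: nearly_convex_def)
  have m_epi: "(xbar, t) \<in> ereal_epigraph f" if "m \<le> t" for t
    using that by (simp add: ereal_epigraph_def m)
  \<comment> \<open>The strict bound makes \<open>?T\<close> disjoint from \<open>C\<close>, while
    its closure still contains \<open>D \<times> {..m}\<close>, in particular
    \<open>(xbar, m)\<close>.\<close>
  let ?T = "E \<times> {..<m}"
  have "C \<noteq> {}" "E \<noteq> {}"
    using C(3) m_epi[of m] E(3) xD by auto
  moreover have "C \<inter> ?T = {}"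
  proof -
    have False if "(x, t) \<in> C" "x \<in> E" "t < m" for x t
    proof -
      have "f x \<le> ereal t" "ereal m \<le> f x"
        using that C(2) E(2) opt m by (auto simp: ereal_epigraph_def)
      then have "ereal m \<le> ereal t"
        by (rule order_trans[rotated])
      then show False
        using that(3) by simp
    qed
    then show ?thesis
      by auto
  qed
  moreover have "?T \<noteq> {}"
    using \<open>E \<noteq> {}\<close> lt_ex[of m] by auto
  moreover have "convex ?T"
    using E(1) by (intro convex_Times) auto
  ultimately obtain p where p: "\<And>x y. x \<in> closure C \<Longrightarrow> y \<in> closure ?T \<Longrightarrow> p \<bullet> y \<le> p \<bullet> x"
    and strict: "\<exists>x\<in>C. \<exists>y\<in>?T. p \<bullet> y < p \<bullet> x"
    using separating_hyperplane_proper[OF C(1), of ?T] by blast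
  obtain a b where ab: "p = (a, b)"
    by fastforce
  have sep: "a \<bullet> y + b * s \<le> a \<bullet> x + b * t"
    if "(x, t) \<in> ereal_epigraph f" "y \<in> D" "s \<le> m" for x t y s
    using p[of "(x, t)" "(y, s)"] that C(3) E(3) by (auto simp: ab closure_Times)
  \<comment> \<open>The points \<open>(xbar, m + 1)\<close> and \<open>(xbar, m)\<close> differ only
    in height.\<close>
  have "b \<ge> 0"
    using sep[OF m_epi[of "m + 1"] xD order_refl] by (simp add: algebra_simps)
  moreover have "b \<noteq> 0"
  proof
    assume "b = 0"
    \<comment> \<open>Heights no longer matter, so the separation descends to
      \<open>eff_domain f\<close> and \<open>D\<close>, which share the point
      \<open>z\<close>.\<close>
    have le: "a \<bullet> y \<le> a \<bullet> x" if "x \<in> eff_domain f" "y \<in> D" for x y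
    proof -
      have "f x > -\<infinity>" "f x < \<infinity>"
        using proper that(1) by (auto simp: proper_function_def eff_domain_def)
      then obtain t where "f x = ereal t"
        by (cases "f x") auto
      then show ?thesis
        using sep[of x t y m] that(2) \<open>b = 0\<close> by (simp add: ereal_epigraph_def)
    qed
    have f_const: "a \<bullet> x = a \<bullet> z" if "x \<in> eff_domain f" for x
      using inner_minimum_rel_interior_constant[OF z(2)] le zD that by blast
    have "(- a) \<bullet> y = (- a) \<bullet> z" if "y \<in> D" for y
      using inner_minimum_rel_interior_constant[OF z(1), of "- a"] le zf that by simp
    then have D_const: "a \<bullet> y = a \<bullet> z" if "y \<in> D" for y
      using that by simp
    obtain x t y s where "(x, t) \<in> C" "y \<in> E" "p \<bullet> (y, s) < p \<bullet> (x, t)"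
      using strict by auto
    moreover from this have "x \<in> eff_domain f"
      using C(2) by (auto simp: ereal_epigraph_def eff_domain_def intro: le_less_trans)
    ultimately show False
      using f_const[of x] D_const[of y] E(2) \<open>b = 0\<close> by (auto simp: ab)
  qed
  ultimately have "b > 0"
    by simp
  \<comment> \<open>Dividing by \<open>b\<close> turns the functional into \<open>(- v, 1)\<close>.
    Comparing the epigraph with \<open>(xbar, m)\<close> then gives the subgradient inequality, and
    comparing \<open>(xbar, m)\<close> with the points \<open>(y, m)\<close> for \<open>y\<close> in
    \<open>D\<close> gives normality of \<open>- v\<close>.\<close>
  define v where "v = (- 1 / b) *\<^sub>R a"
  have v: "v \<bullet> w = - (a \<bullet> w) / b" for w
    by (simp add: v_def)
  have "ereal (v \<bullet> (x - xbar)) \<le> f x - f xbar" for x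
  proof (cases "f x")
    case (real t)
    have "a \<bullet> xbar + b * m \<le> a \<bullet> x + b * t"
      using sep[of x t xbar m] xD real by (simp add: ereal_epigraph_def)
    then show ?thesis
      using \<open>b > 0\<close> real m by (simp add: v inner_diff_right field_simps)
  qed (use proper m in \<open>auto simp: proper_function_def\<close>)
  then have "v \<in> subdifferential f xbar"
    by (simp add: subdifferential_def m)
  moreover have "(- v) \<bullet> (y - xbar) \<le> 0" if "y \<in> D" for y
    using sep[OF m_epi[of m] that order_refl] \<open>b > 0\<close>
    by (simp add: v inner_diff_right divide_right_mono)
  ultimately show ?thesis
    using that xD by (simp add: normal_cone_def)
qed

text \<open>On \<open>D\<close> the increment of \<open>f\<close> from \<open>xbar\<close> is at
  least \<open>v \<bullet> (x - xbar)\<close>, which is nonnegative because \<open>- v\<close> is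
  normal to \<open>D\<close>.\<close>

lemma subgradient_imp_solution_set:
  assumes "0 \<in> subdifferential f xbar + normal_cone xbar D"
  shows "xbar \<in> solution_set f D"
proof -
  obtain v w where vw: "v + w = 0" "v \<in> subdifferential f xbar" "w \<in> normal_cone xbar D"
    using assms by (metis set_plus_elim)
  have "w = - v"
    using vw(1) by (simp add: eq_neg_iff_add_eq_0 add.commute)
  have fin: "\<bar>f xbar\<bar> \<noteq> \<infinity>" and sub: "\<And>x. ereal (v \<bullet> (x - xbar)) \<le> f x - f xbar"
    using vw(2) by (auto simp: subdifferential_def split: if_splits)
  have xD: "xbar \<in> D" and nor: "\<And>x. x \<in> D \<Longrightarrow> 0 \<le> v \<bullet> (x - xbar)"
    using vw(3) \<open>w = - v\<close> by (auto simp: normal_cone_def split: if_splits)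
  have "f xbar \<le> f x" if "x \<in> D" for x
  proof -
    have "0 \<le> f x - f xbar"
      using sub[of x] nor[OF that] by (meson ereal_less_eq(5) order_trans)
    then show ?thesis
      using fin by (cases "f x"; cases "f xbar") auto
  qed
  then show ?thesis
    using xD by (simp add: solution_set_def)
qed

text \<open>For the zero subgradient the defining inequality is trivial off \<open>D\<close>, where
  the sum is infinite, and is exactly optimality on \<open>D\<close>.\<close>

lemma solution_set_iff_zero_subgradient:
  assumes "\<And>x. f x > -\<infinity>" and xD: "xbar \<in> D" and fin: "\<bar>f xbar\<bar> \<noteq> \<infinity>"
  shows "xbar \<in> solution_set f D \<longleftrightarrow>
    0 \<in> subdifferential (\<lambda>x. f x + convex_indicator D x) xbar"
proof -
  obtain m where m: "f xbar = ereal m"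
    using fin by auto
  let ?h = "\<lambda>x. f x + convex_indicator D x"
  have h_xbar: "?h xbar = ereal m"
    using xD by (simp add: convex_indicator_def m)
  have "0 \<le> ?h x - ereal m \<longleftrightarrow> (x \<in> D \<longrightarrow> ereal m \<le> f x)" for x
    using assms(1)[of x] by (cases "f x") (auto simp: convex_indicator_def)
  then have "0 \<in> subdifferential ?h xbar \<longleftrightarrow> (\<forall>x. x \<in> D \<longrightarrow> ereal m \<le> f x)"
    unfolding subdifferential_def h_xbar by (simp flip: zero_ereal_def)
  then show ?thesis
    using xD by (auto simp: solution_set_def m)
qed

theorem theorem4p1:
  fixes f :: "real ^ 'n \<Rightarrow> ereal" and D :: "(real ^ 'n) set"
  assumes "proper_function f" and "nearly_convex_function f"
    and "D \<noteq> {}" and "nearly_convex D"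
  shows "(\<forall>xbar\<in>D. \<bar>f xbar\<bar> \<noteq> \<infinity> \<longrightarrow>
            (xbar \<in> solution_set f D \<longleftrightarrow>
             0 \<in> subdifferential (\<lambda>x. f x + convex_indicator D x) xbar)) \<and>
         (rel_interior D \<inter> rel_interior (eff_domain f) \<noteq> {} \<longrightarrow>
            (\<forall>xbar\<in>D. xbar \<in> solution_set f D \<longleftrightarrow>
               0 \<in> subdifferential f xbar + normal_cone xbar D) \<and>
            solution_set f D = {xbar. 0 \<in> subdifferential f xbar + normal_cone xbar D})"
proof -
  \<comment> \<open>Here \<open>xbar\<close> ranges over the whole space, so the equality of sets
    follows too: off \<open>D\<close> the normal cone is empty and both sides are false.\<close>
  have "xbar \<in> solution_set f D \<longleftrightarrow> 0 \<in> subdifferential f xbar + normal_cone xbar D"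
    if ri: "rel_interior D \<inter> rel_interior (eff_domain f) \<noteq> {}" for xbar
  proof
    assume sol: "xbar \<in> solution_set f D"
    obtain z where "z \<in> rel_interior D" "z \<in> rel_interior (eff_domain f)"
      using ri by blast
    then obtain v where "v \<in> subdifferential f xbar" "- v \<in> normal_cone xbar D"
      using solution_set_imp_subgradient[OF assms(1,2,4) _ _ sol] by metis
    then show "0 \<in> subdifferential f xbar + normal_cone xbar D"
      using set_plus_intro[of v _ "- v"] by simp
  qed (rule subgradient_imp_solution_set)
  moreover have "xbar \<in> solution_set f D \<longleftrightarrow>
      0 \<in> subdifferential (\<lambda>x. f x + convex_indicator D x) xbar"
    if "xbar \<in> D" "\<bar>f xbar\<bar> \<noteq> \<infinity>" for xbar
    using solution_set_iff_zero_subgradient[of f xbar D] that assms(1)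
    by (simp add: proper_function_def)
  ultimately show ?thesis
    by auto
qed

end
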